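(* Let $\mathcal{F}$ be a saturated fusion system over a finite $p$-group $S$, and let $\mathcal{P}^*$ be a set of chosen fully normalized representatives, one for each $\mathcal{F}$-conjugacy class of subgroups of $S$. Let $\mathrm{FMob}$ be the square matrix with rows and columns indexed by $\mathcal{P}^*$ and entries $$\mathrm{FMob}_{Q^*,P^*} := \sum_{[P]_S\subseteq [P^*]_{\mathcal{F}}} \mathrm{Mob}_{Q^*,P},$$ where $\mathrm{Mob}=\mathrm{Mark}^{-1}$ is the inverse (over $\mathbb{Q}$) of the table of marks of $S$. Then $\mathrm{FMob}$ is invertible, and its inverse $\mathrm{FMark}:=\mathrm{FMob}^{-1}$ is the matrix of marks for $A(\mathcal{F})$, i.e. $$\mathrm{FMark}_{Q^*,P^*} = \left|(\alpha_{P^*})^{Q^*}\right| \quad\text{for all } Q^*,P^*\in\mathcal{P}^*.$$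
   Context: A fusion system $\mathcal{F}$ on a finite $p$-group $S$, and its being saturated, are meant in the standard sense (Aschbacher–Kessar–Oliver). Subgroups $P,Q\le S$ are $\mathcal{F}$-conjugate, written $P\sim_{\mathcal{F}}Q$, if they are isomorphic in $\mathcal{F}$; $[P]_{\mathcal{F}}$ and $[P]_S$ denote the $\mathcal{F}$-conjugacy class and the $S$-conjugacy class of $P$. A subgroup $P$ is fully normalized (in $\mathcal{F}$) if $|N_S(P)|\ge |N_S(P')|$ for all $P'\sim_{\mathcal{F}}P$. $\mathrm{Mark}$ is the table of marks of $S$: the matrix with rows and columns indexed by $S$-conjugacy classes of subgroups of $S$ and entries $\mathrm{Mark}_{Q,P}=|(S/P)^Q|=|\{s\in S\mid sQs^{-1}\le P\}|/|P|$. It is invertible over $\mathbb{Q}$. In the sum defining $\mathrm{FMob}$, one term appears for each $S$-conjugacy class $[P]_S$ contained in $[P^*]_{\mathcal{F}}$. For a finite $S$-set $X$ and $Q\le S$, $X^Q$ is the set of $Q$-fixed points and $c_Q(X)$ is the number of orbits of $X$ isomorphic to $S/Q$. A finite $S$-set $X$ is $\mathcal{F}$-stable if for all $P\le S$ and all $\varphi\in\mathcal{F}(P,S)$ the $P$-set obtained by restricting the action along $\varphi$ is isomorphic to the $P$-set obtained by restricting along the inclusion; equivalently, $|X^P|=|X^{Q}|$ whenever $P\sim_{\mathcal{F}}Q$. The Burnside ring $A(\mathcal{F})$ is the Grothendieck ring of the semiring of isomorphism classes of finite $\mathcal{F}$-stable $S$-sets (disjoint union as addition, cartesian product as multiplication).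 It is known (Reeh) that for each $\mathcal{F}$-conjugacy class $[P]_{\mathcal{F}}$ there is a unique (up to $S$-isomorphism) $\mathcal{F}$-stable $S$-set $\alpha_P$ such that (1) $c_Q(\alpha_P)=1$ if $Q$ is fully normalized and $Q\sim_{\mathcal{F}}P$; (2) $c_Q(\alpha_P)=0$ if $Q$ is fully normalized and $Q\not\sim_{\mathcal{F}}P$. The sets $\alpha_P$ (one for each $\mathcal{F}$-conjugacy class) form an additive basis of the monoid of $\mathcal{F}$-stable $S$-sets. *)

theory Defs
  imports Complex_Main "HOL-Algebra.Group_Action" "HOL-Algebra.Left_Coset"
    "HOL-Computational_Algebra.Primes"
begin

section \<open>Matrices indexed by a finite set\<close>

text \<open>A square matrix with index set \<open>I\<close> is a two-argument function of which only the values
  on \<open>I \<times> I\<close> matter.\<close>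

definition mutually_inverse_on ::
    "'i set \<Rightarrow> ('i \<Rightarrow> 'i \<Rightarrow> 'k::comm_ring_1) \<Rightarrow> ('i \<Rightarrow> 'i \<Rightarrow> 'k) \<Rightarrow> bool" where
  "mutually_inverse_on I A B \<longleftrightarrow>
     (\<forall>i\<in>I. \<forall>j\<in>I. (\<Sum>k\<in>I. A i k * B k j) = (if i = j then 1 else 0)) \<and>
     (\<forall>i\<in>I. \<forall>j\<in>I. (\<Sum>k\<in>I. B i k * A k j) = (if i = j then 1 else 0))"

definition invertible_on :: "'i set \<Rightarrow> ('i \<Rightarrow> 'i \<Rightarrow> 'k::comm_ring_1) \<Rightarrow> bool" where
  "invertible_on I A \<longleftrightarrow> (\<exists>B. mutually_inverse_on I A B)"

text \<open>The inverse is determined only on \<open>I \<times> I\<close>, and only if \<open>A\<close> is invertible.\<close>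

definition inverse_on :: "'i set \<Rightarrow> ('i \<Rightarrow> 'i \<Rightarrow> 'k::comm_ring_1) \<Rightarrow> 'i \<Rightarrow> 'i \<Rightarrow> 'k" where
  "inverse_on I A = (SOME B. mutually_inverse_on I A B)"

lemma mutually_inverse_on_inverse_on:
  "invertible_on I A \<Longrightarrow> mutually_inverse_on I A (inverse_on I A)"
  unfolding invertible_on_def inverse_on_def by (metis someI_ex)

lemma mutually_inverse_on_unique:
  assumes "finite I" "mutually_inverse_on I A B" "mutually_inverse_on I A C" "i \<in> I" "j \<in> I"
  shows "B i j = C i j"
proof -
  have "B i j = (\<Sum>k\<in>I. if k = j then B i k else 0)"
    using assms(1,5) by simp
  also have "\<dots> = (\<Sum>k\<in>I. B i k * (if k = j then 1 else 0))"
    by (intro sum.cong) auto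
  also have "\<dots> = (\<Sum>k\<in>I. B i k * (\<Sum>l\<in>I. A k l * C l j))"
    using assms unfolding mutually_inverse_on_def by (intro sum.cong) auto
  also have "\<dots> = (\<Sum>k\<in>I. \<Sum>l\<in>I. B i k * A k l * C l j)"
    by (simp add: sum_distrib_left mult.assoc)
  also have "\<dots> = (\<Sum>l\<in>I. \<Sum>k\<in>I. B i k * A k l * C l j)"
    by (rule sum.swap)
  also have "\<dots> = (\<Sum>l\<in>I. (\<Sum>k\<in>I. B i k * A k l) * C l j)"
    by (simp add: sum_distrib_right)
  also have "\<dots> = (\<Sum>l\<in>I. if i = l then C l j else 0)"
    using assms unfolding mutually_inverse_on_def by (intro sum.cong) auto
  also have "\<dots> = C i j"
    using assms(1,4) by simp
  finally show ?thesis .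
qed


section \<open>Subgroups up to conjugacy in \<open>S\<close>\<close>

definition conj_map :: "('a, 'm) monoid_scheme \<Rightarrow> 'a \<Rightarrow> 'a \<Rightarrow> 'a" where
  "conj_map S g x = g \<otimes>\<^bsub>S\<^esub> x \<otimes>\<^bsub>S\<^esub> inv\<^bsub>S\<^esub> g"

definition S_class :: "('a, 'm) monoid_scheme \<Rightarrow> 'a set \<Rightarrow> 'a set set" where
  "S_class S P = {conj_map S g ` P | g. g \<in> carrier S}"

definition subgroup_classes :: "('a, 'm) monoid_scheme \<Rightarrow> 'a set set set" where
  "subgroup_classes S = {S_class S P | P. subgroup P S}"


section \<open>Fusion systems\<close>

text \<open>A morphism \<open>P \<rightarrow> Q\<close> is a function that is \<^const>\<open>undefined\<close> outside \<open>P\<close>, so that morphisms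
  are equal iff they agree on \<open>P\<close>; composition of \<open>f : P \<rightarrow> Q\<close> with \<open>g : Q \<rightarrow> R\<close>
  is \<open>compose P g f\<close>.\<close>

definition Inj_hom :: "('a, 'm) monoid_scheme \<Rightarrow> 'a set \<Rightarrow> 'a set \<Rightarrow> ('a \<Rightarrow> 'a) set" where
  "Inj_hom S P Q = mon (S\<lparr>carrier := P\<rparr>) (S\<lparr>carrier := Q\<rparr>) \<inter> extensional P"

definition Hom_S :: "('a, 'm) monoid_scheme \<Rightarrow> 'a set \<Rightarrow> 'a set \<Rightarrow> ('a \<Rightarrow> 'a) set" where
  "Hom_S S P Q =
     {restrict (conj_map S g) P | g. g \<in> carrier S \<and> conj_map S g ` P \<subseteq> Q}"

text \<open>\<open>F P Q\<close> is the set of morphisms from \<open>P\<close> to \<open>Q\<close>; it is only meaningful for subgroups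
  \<open>P\<close>, \<open>Q\<close> of \<open>S\<close>.\<close>

definition Iso_F ::
    "('a set \<Rightarrow> 'a set \<Rightarrow> ('a \<Rightarrow> 'a) set) \<Rightarrow> 'a set \<Rightarrow> 'a set \<Rightarrow> ('a \<Rightarrow> 'a) set" where
  "Iso_F F P Q = {f \<in> F P Q. \<exists>g \<in> F Q P.
     compose P g f = (\<lambda>x\<in>P. x) \<and> compose Q f g = (\<lambda>x\<in>Q. x)}"

definition F_conj ::
    "('a, 'm) monoid_scheme \<Rightarrow> ('a set \<Rightarrow> 'a set \<Rightarrow> ('a \<Rightarrow> 'a) set) \<Rightarrow> 'a set \<Rightarrow> 'a set \<Rightarrow> bool" where
  "F_conj S F P Q \<longleftrightarrow> subgroup P S \<and> subgroup Q S \<and> Iso_F F P Q \<noteq> {}"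

definition F_class ::
    "('a, 'm) monoid_scheme \<Rightarrow> ('a set \<Rightarrow> 'a set \<Rightarrow> ('a \<Rightarrow> 'a) set) \<Rightarrow> 'a set \<Rightarrow> 'a set set" where
  "F_class S F P = {Q. F_conj S F P Q}"

definition fully_normalized ::
    "('a, 'm) monoid_scheme \<Rightarrow> ('a set \<Rightarrow> 'a set \<Rightarrow> ('a \<Rightarrow> 'a) set) \<Rightarrow> 'a set \<Rightarrow> bool" where
  "fully_normalized S F P \<longleftrightarrow> subgroup P S \<and>
     (\<forall>P'. F_conj S F P' P \<longrightarrow> card (normalizer S P') \<le> card (normalizer S P))"

locale fusion_system = group S for S (structure) +
  fixes p :: nat and F :: "'a set \<Rightarrow> 'a set \<Rightarrow> ('a \<Rightarrow> 'a) set"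
  assumes prime_p: "prime p"
    and finite_S: "finite (carrier S)"
    and p_group_S: "\<exists>n. order S = p ^ n"
    and F_comp: "\<lbrakk>subgroup P S; subgroup Q S; subgroup R S; f \<in> F P Q; g \<in> F Q R\<rbrakk>
                   \<Longrightarrow> compose P g f \<in> F P R"
    and Hom_S_subset: "\<lbrakk>subgroup P S; subgroup Q S\<rbrakk> \<Longrightarrow> Hom_S S P Q \<subseteq> F P Q"
    and F_subset_Inj: "\<lbrakk>subgroup P S; subgroup Q S\<rbrakk> \<Longrightarrow> F P Q \<subseteq> Inj_hom S P Q"
    \<comment> \<open>Every morphism is an isomorphism of the category onto its image, followed by an inclusion.\<close>
    and F_factor: "\<lbrakk>subgroup P S; subgroup Q S; f \<in> F P Q\<rbrakk> \<Longrightarrow> f \<in> Iso_F F P (f ` P)"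

definition sylow_p_subgroup :: "nat \<Rightarrow> 'g set \<Rightarrow> ('g, 'm) monoid_scheme \<Rightarrow> bool" where
  "sylow_p_subgroup p H G \<longleftrightarrow> subgroup H G \<and> card H = p ^ multiplicity p (order G)"

definition Aut_group ::
    "('a set \<Rightarrow> 'a set \<Rightarrow> ('a \<Rightarrow> 'a) set) \<Rightarrow> 'a set \<Rightarrow> ('a \<Rightarrow> 'a) monoid" where
  "Aut_group F P = BijGroup P \<lparr>carrier := F P P\<rparr>"

definition fully_automized ::
    "('a, 'm) monoid_scheme \<Rightarrow> nat \<Rightarrow> ('a set \<Rightarrow> 'a set \<Rightarrow> ('a \<Rightarrow> 'a) set) \<Rightarrow> 'a set \<Rightarrow> bool" where
  "fully_automized S p F P \<longleftrightarrow> sylow_p_subgroup p (Hom_S S P P) (Aut_group F P)"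

text \<open>For an isomorphism \<open>f : Q \<rightarrow> P\<close>, the elements \<open>g\<close> of the normalizer of \<open>Q\<close> with
  \<open>f \<circ> c\<^sub>g \<circ> f\<inverse> \<in> Aut\<^sub>S(P)\<close>.\<close>

definition N_phi ::
    "('a, 'm) monoid_scheme \<Rightarrow> 'a set \<Rightarrow> 'a set \<Rightarrow> ('a \<Rightarrow> 'a) \<Rightarrow> 'a set" where
  "N_phi S Q P f = {g \<in> normalizer S Q.
     (\<lambda>x\<in>P. f (conj_map S g (inv_into Q f x))) \<in> Hom_S S P P}"

definition receptive ::
    "('a, 'm) monoid_scheme \<Rightarrow> ('a set \<Rightarrow> 'a set \<Rightarrow> ('a \<Rightarrow> 'a) set) \<Rightarrow> 'a set \<Rightarrow> bool" where
  "receptive S F P \<longleftrightarrow> (\<forall>Q f. subgroup Q S \<longrightarrow> f \<in> Iso_F F Q P \<longrightarrow>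
     (\<exists>h \<in> F (N_phi S Q P f) (carrier S). restrict h Q = f))"

locale saturated_fusion_system = fusion_system +
  assumes saturated: "subgroup P S \<Longrightarrow>
    \<exists>Q. F_conj S F P Q \<and> fully_automized S p F Q \<and> receptive S F Q"


section \<open>\<open>S\<close>-sets\<close>

text \<open>An \<open>S\<close>-set is a set \<open>E\<close> with an action \<open>act\<close> as in \<^locale>\<open>group_action\<close>.\<close>

definition fixed_points :: "'b set \<Rightarrow> ('a \<Rightarrow> 'b \<Rightarrow> 'b) \<Rightarrow> 'a set \<Rightarrow> 'b set" where
  "fixed_points E act Q = {x \<in> E. \<forall>q\<in>Q. act q x = x}"

definition action_iso :: "'a set \<Rightarrow> 'b set \<Rightarrow> ('a \<Rightarrow> 'b \<Rightarrow> 'b) \<Rightarrow>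
    'c set \<Rightarrow> ('a \<Rightarrow> 'c \<Rightarrow> 'c) \<Rightarrow> bool" where
  "action_iso P E act E' act' \<longleftrightarrow>
     (\<exists>h. bij_betw h E E' \<and> (\<forall>u\<in>P. \<forall>x\<in>E. h (act u x) = act' u (h x)))"

text \<open>The \<open>S\<close>-set \<open>S/P\<close> is \<^term>\<open>lcosets\<^bsub>S\<^esub> P\<close> with action \<open>coset_act S P\<close>.\<close>

definition coset_act :: "('a, 'm) monoid_scheme \<Rightarrow> 'a set \<Rightarrow> 'a \<Rightarrow> 'a set \<Rightarrow> 'a set" where
  "coset_act S P g = (\<lambda>C \<in> lcosets\<^bsub>S\<^esub> P. g <#\<^bsub>S\<^esub> C)"

definition orbit_count ::
    "('a, 'm) monoid_scheme \<Rightarrow> 'b set \<Rightarrow> ('a \<Rightarrow> 'b \<Rightarrow> 'b) \<Rightarrow> 'a set \<Rightarrow> nat" where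
  "orbit_count S E act Q =
     card {X \<in> orbits S E act. action_iso (carrier S) X act (lcosets\<^bsub>S\<^esub> Q) (coset_act S Q)}"

definition F_stable :: "('a, 'm) monoid_scheme \<Rightarrow> ('a set \<Rightarrow> 'a set \<Rightarrow> ('a \<Rightarrow> 'a) set) \<Rightarrow>
    'b set \<Rightarrow> ('a \<Rightarrow> 'b \<Rightarrow> 'b) \<Rightarrow> bool" where
  "F_stable S F E act \<longleftrightarrow> (\<forall>P f. subgroup P S \<longrightarrow> f \<in> F P (carrier S) \<longrightarrow>
     action_iso P E (\<lambda>u. act (f u)) E act)"

text \<open>The defining properties of the basis element \<open>\<alpha>\<^sub>P\<close>, which determine it up to isomorphism
  of \<open>S\<close>-sets.\<close>

definition is_alpha :: "('a, 'm) monoid_scheme \<Rightarrow> ('a set \<Rightarrow> 'a set \<Rightarrow> ('a \<Rightarrow> 'a) set) \<Rightarrow>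
    'a set \<Rightarrow> 'b set \<Rightarrow> ('a \<Rightarrow> 'b \<Rightarrow> 'b) \<Rightarrow> bool" where
  "is_alpha S F P E act \<longleftrightarrow> group_action S E act \<and> finite E \<and> F_stable S F E act \<and>
     (\<forall>Q. fully_normalized S F Q \<longrightarrow>
        orbit_count S E act Q = (if F_conj S F Q P then 1 else 0))"


section \<open>Tables of marks\<close>

text \<open>The entry \<open>|(S/P)\<^sup>Q|\<close> does not depend on the representatives \<open>Q\<close>, \<open>P\<close> of the two
  conjugacy classes (lemma \<open>Mark_S_class\<close> below).\<close>

definition Mark :: "('a, 'm) monoid_scheme \<Rightarrow> 'a set set \<Rightarrow> 'a set set \<Rightarrow> rat" where
  "Mark S X Y = (let Q = (SOME Q. Q \<in> X); P = (SOME P. P \<in> Y) in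
     of_nat (card (fixed_points (lcosets\<^bsub>S\<^esub> P) (coset_act S P) Q)))"

definition Mob :: "('a, 'm) monoid_scheme \<Rightarrow> 'a set set \<Rightarrow> 'a set set \<Rightarrow> rat" where
  "Mob S = inverse_on (subgroup_classes S) (Mark S)"

definition FMob :: "('a, 'm) monoid_scheme \<Rightarrow> ('a set \<Rightarrow> 'a set \<Rightarrow> ('a \<Rightarrow> 'a) set) \<Rightarrow>
    'a set \<Rightarrow> 'a set \<Rightarrow> rat" where
  "FMob S F Q P =
     (\<Sum>X \<in> {X \<in> subgroup_classes S. X \<subseteq> F_class S F P}. Mob S (S_class S Q) X)"

definition fully_normalized_representatives ::
    "('a, 'm) monoid_scheme \<Rightarrow> ('a set \<Rightarrow> 'a set \<Rightarrow> ('a \<Rightarrow> 'a) set) \<Rightarrow> 'a set set \<Rightarrow> bool" where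
  "fully_normalized_representatives S F Pstar \<longleftrightarrow>
     (\<forall>P\<in>Pstar. fully_normalized S F P) \<and>
     (\<forall>Q. subgroup Q S \<longrightarrow> (\<exists>!P. P \<in> Pstar \<and> F_conj S F P Q))"

context group
begin

lemma two_sided_translate_fixed:
  assumes QG: "Q \<subseteq> carrier G" and PG: "P \<subseteq> carrier G"
    and g: "g \<in> carrier G" and h: "h \<in> carrier G"
    and C: "C \<in> fixed_points (lcosets P) (coset_act G P) Q"
  shows "g <# (C #> inv h) \<in>
    fixed_points (lcosets (conj_map G h ` P)) (coset_act G (conj_map G h ` P)) (conj_map G g ` Q)"
proof -
  have hPG: "conj_map G h ` P \<subseteq> carrier G"
    using PG h by (auto simp: conj_map_def)
  have CL: "C \<in> lcosets P" and fx: "\<And>q. q \<in> Q \<Longrightarrow> q <# C = C"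
    using C by (auto simp: fixed_points_def coset_act_def)
  obtain a where a: "a \<in> carrier G" "C = a <# P"
    using CL by (auto simp: LCOSETS_def)
  have CG: "C \<subseteq> carrier G"
    using a PG l_coset_subset_G by auto
  let ?D = "g <# (C #> inv h)"
  have "?D = (g \<otimes> a \<otimes> inv h) <# (conj_map G h ` P)"
  proof -
    have "g \<otimes> (a \<otimes> x \<otimes> inv h) = g \<otimes> a \<otimes> inv h \<otimes> (h \<otimes> x \<otimes> inv h)" if "x \<in> P" for x
    proof -
      have x: "x \<in> carrier G" using that PG by auto
      have "inv h \<otimes> (h \<otimes> (x \<otimes> inv h)) = x \<otimes> inv h"
        using x h by (simp add: m_assoc[symmetric])
      then show ?thesis
        using x a g h by (simp add: m_assoc)
    qed
    then show ?thesis
      unfolding a(2) l_coset_def r_coset_def conj_map_def by auto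
  qed
  moreover have "g \<otimes> a \<otimes> inv h \<in> carrier G"
    using a g h by simp
  ultimately have D: "?D \<in> lcosets (conj_map G h ` P)"
    unfolding LCOSETS_def by blast
  have "conj_map G g q <# ?D = ?D" if q: "q \<in> Q" for q
  proof -
    have qG: "q \<in> carrier G" using q QG by auto
    have *: "C #> inv h \<subseteq> carrier G"
      using CG h by (simp add: r_coset_subset_G)
    have "conj_map G g q <# ?D = (g \<otimes> q \<otimes> inv g \<otimes> g) <# (C #> inv h)"
      using qG g * by (simp add: conj_map_def lcos_m_assoc)
    also have "g \<otimes> q \<otimes> inv g \<otimes> g = g \<otimes> q"
      using qG g by (simp add: m_assoc)
    also have "(g \<otimes> q) <# (C #> inv h) = g <# (q <# (C #> inv h))"
      using qG g * by (simp add: lcos_m_assoc)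
    also have "q <# (C #> inv h) = (q <# C) #> inv h"
      using qG h CG by (simp add: coset_assoc)
    finally show ?thesis using fx[OF q] by simp
  qed
  then have "\<forall>r \<in> conj_map G g ` Q. r <# ?D = ?D"
    by blast
  then show ?thesis
    using D unfolding fixed_points_def coset_act_def by simp
qed

lemma conj_map_image_inv:
  assumes "P \<subseteq> carrier G" "g \<in> carrier G"
  shows "conj_map G (inv g) ` (conj_map G g ` P) = P"
proof -
  have "conj_map G (inv g) (conj_map G g x) = x" if "x \<in> P" for x
  proof -
    have x: "x \<in> carrier G" using that assms by auto
    have "inv g \<otimes> (g \<otimes> x) = x"
      using x assms(2) by (simp add: m_assoc[symmetric])
    then show ?thesis
      using x assms(2) by (simp add: conj_map_def m_assoc)
  qed
  then show ?thesis by (force simp: image_image)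
qed

lemma card_fixed_points_conj:
  assumes Q: "subgroup Q G" and P: "subgroup P G" and g: "g \<in> carrier G" and h: "h \<in> carrier G"
  shows "card (fixed_points (lcosets (conj_map G h ` P)) (coset_act G (conj_map G h ` P))
      (conj_map G g ` Q)) = card (fixed_points (lcosets P) (coset_act G P) Q)"
proof -
  have cl: "C \<subseteq> carrier G"
    if "R \<subseteq> carrier G" "C \<in> fixed_points (lcosets R) (coset_act G R) T" for R C T
    using that by (auto simp: fixed_points_def LCOSETS_def dest: l_coset_subset_G)
  have subset: "Q \<subseteq> carrier G" "P \<subseteq> carrier G"
    using P Q subgroup.subset by auto
  have subset': "conj_map G g ` Q \<subseteq> carrier G" "conj_map G h ` P \<subseteq> carrier G"
    using subset g h by (auto simp: conj_map_def)
  have undo: "inv x <# ((x <# (C #> inv y)) #> y) = C"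
    if "x \<in> carrier G" "y \<in> carrier G" "C \<subseteq> carrier G" for x y C
  proof -
    have *: "C #> inv y \<subseteq> carrier G"
      using that by (simp add: r_coset_subset_G)
    have "(x <# (C #> inv y)) #> y = x <# C"
      using that * by (simp add: coset_assoc[symmetric] coset_mult_assoc)
    then show ?thesis
      using that by (simp add: lcos_m_assoc lcos_mult_one)
  qed
  have "bij_betw (\<lambda>C. g <# (C #> inv h))
    (fixed_points (lcosets P) (coset_act G P) Q)
    (fixed_points (lcosets (conj_map G h ` P)) (coset_act G (conj_map G h ` P)) (conj_map G g ` Q))"
    (is "bij_betw ?f ?A ?B")
  proof (rule bij_betw_byWitness[where f' = "\<lambda>C. inv g <# (C #> h)"])
    show "\<forall>C\<in>?A. inv g <# (?f C #> h) = C"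
      using undo[OF g h] cl[OF subset(2)] by blast
    have "g <# ((inv g <# (C #> h)) #> inv h) = C" if "C \<subseteq> carrier G" for C
      using undo[of "inv g" "inv h" C] g h that by simp
    then show "\<forall>C\<in>?B. ?f (inv g <# (C #> h)) = C"
      using cl[OF subset'(2)] by blast
    show "?f ` ?A \<subseteq> ?B"
      using two_sided_translate_fixed[OF subset g h] by blast
    show "(\<lambda>C. inv g <# (C #> h)) ` ?B \<subseteq> ?A"
      using two_sided_translate_fixed[OF subset', of "inv g" "inv h"]
      by (auto simp only: conj_map_image_inv[OF subset(1) g] conj_map_image_inv[OF subset(2) h]
          inv_closed[OF g] inv_closed[OF h] inv_inv[OF h])
  qed
  then show ?thesis by (simp add: bij_betw_same_card)
qed

lemma Mark_S_class:
  assumes Q: "subgroup Q G" and P: "subgroup P G"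
  shows "Mark G (S_class G Q) (S_class G P) =
    of_nat (card (fixed_points (lcosets P) (coset_act G P) Q))"
proof -
  have ex: "\<exists>g \<in> carrier G. (SOME R'. R' \<in> S_class G R) = conj_map G g ` R" for R
  proof -
    have "conj_map G \<one> ` R \<in> S_class G R"
      unfolding S_class_def by blast
    then have "(SOME R'. R' \<in> S_class G R) \<in> S_class G R"
      by (rule someI)
    then show ?thesis
      by (simp only: S_class_def mem_Collect_eq) blast
  qed
  obtain g where g: "g \<in> carrier G" "(SOME Q'. Q' \<in> S_class G Q) = conj_map G g ` Q"
    using ex[of Q] by (elim bexE)
  obtain h where h: "h \<in> carrier G" "(SOME P'. P' \<in> S_class G P) = conj_map G h ` P"
    using ex[of P] by (elim bexE)
  show ?thesis
    unfolding Mark_def Let_def g(2) h(2) card_fixed_points_conj[OF Q P g(1) h(1)] by (rule refl)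
qed

end

end

theory Submission
  imports Defs
begin

text \<open>The column of \<open>FMob\<close> at \<open>P\<close> is the image under \<open>Mob\<close> of the indicator function of the
  \<open>F\<close>-class of \<open>P\<close>, read off at the fully normalized representatives. Since \<open>Mark\<close>, hence
  \<open>Mob\<close>, is triangular with respect to the order of subgroups, so is \<open>FMob\<close>, with the same
  nonzero diagonal entries; this gives invertibility over the rationals without constructing
  the sets \<open>\<alpha>\<^sub>P\<close>. Decomposing an \<open>S\<close>-set into orbits shows that \<open>Mob\<close> turns its marks into its
  orbit counts. The marks of \<open>\<alpha>\<^sub>P\<close> are constant on \<open>F\<close>-classes, so \<open>FMob\<close> turns their restriction
  to the representatives into the orbit counts of \<open>\<alpha>\<^sub>P\<close> there, which form a unit vector.\<close>

section \<open>Triangular matrices\<close>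

text \<open>The weight \<open>w\<close> need not be injective: distinct indices of equal weight have
  zero entries in both directions, so no linear order refining \<open>w\<close> has to be chosen.
  Below, the weight is the order of a subgroup.\<close>

definition triangular_on :: "'i set \<Rightarrow> ('i \<Rightarrow> nat) \<Rightarrow> ('i \<Rightarrow> 'i \<Rightarrow> 'k::comm_ring_1) \<Rightarrow> bool" where
  "triangular_on I w A \<longleftrightarrow>
     (\<forall>i\<in>I. A i i \<noteq> 0) \<and> (\<forall>i\<in>I. \<forall>j\<in>I. A i j \<noteq> 0 \<longrightarrow> i = j \<or> w i < w j)"

text \<open>Indices are adjoined in order of increasing weight, so each step adds a row that
  vanishes off the diagonal. Triangularity of the inverse is carried through the induction because
  \<open>FMob\<close> is built from the entries of an inverse.\<close>

lemma triangular_on_has_inverse: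
  fixes A :: "'i \<Rightarrow> 'i \<Rightarrow> 'k::field"
  assumes "finite I" "triangular_on I w A"
  shows "\<exists>B. mutually_inverse_on I A B \<and> triangular_on I w B"
  using assms
proof (induction I rule: finite_ranking_induct[where f = w])
  case empty
  then show ?case by (simp add: mutually_inverse_on_def triangular_on_def)
next
  case (insert m J)
  show ?case
  \<comment> \<open>The ranking induction does not guarantee that the inserted index is new.\<close>
  proof (cases "m \<in> J")
    case True
    then show ?thesis using insert by (simp add: insert_absorb)
  next
    case mJ: False
    have tri: "triangular_on J w A"
      using insert.prems by (simp add: triangular_on_def)
    then obtain B where inv: "mutually_inverse_on J A B" and B: "triangular_on J w B"
      using insert.IH by blast
    have d: "A m m \<noteq> 0"
      using insert.prems by (simp add: triangular_on_def)
    \<comment> \<open>By the ranking \<open>w j \<le> w m\<close>, whereas a nonzero entry off the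
      diagonal would need \<open>w m < w j\<close>.\<close>
    have row: "A m j = 0" if "j \<in> J" for j
      using insert.prems insert.hyps(2)[OF that] mJ that
      unfolding triangular_on_def by (metis insertCI leD)
    \<comment> \<open>The inverse of the block matrix with rows \<open>(A, a)\<close> and \<open>(0, d)\<close> has rows
      \<open>(B, - B a / d)\<close> and \<open>(0, 1 / d)\<close>.\<close>
    define C where "C i j = (if j = m then if i = m then 1 / A m m
        else - (\<Sum>k\<in>J. B i k * A k m) / A m m else if i = m then 0 else B i j)" for i j
    have C1: "C m m = 1 / A m m" "\<And>j. j \<in> J \<Longrightarrow> C m j = 0"
      "\<And>i j. i \<in> J \<Longrightarrow> j \<in> J \<Longrightarrow> C i j = B i j"
      "\<And>i. i \<in> J \<Longrightarrow> C i m = - (\<Sum>k\<in>J. B i k * A k m) / A m m"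
      using mJ by (auto simp: C_def)
    have ne: "j \<noteq> m" "m \<noteq> j" if "j \<in> J" for j
      using that mJ by auto
    have AB: "(\<Sum>k\<in>J. A i k * B k j) = (if i = j then 1 else 0)"
      and BA: "(\<Sum>k\<in>J. B i k * A k j) = (if i = j then 1 else 0)" if "i \<in> J" "j \<in> J" for i j
      using inv that by (auto simp: mutually_inverse_on_def)
    \<comment> \<open>With a the new column, this is A (B a) = (A B) a = a. It settles the last
      column of the product of \<open>A\<close> and \<open>C\<close>.\<close>
    have ABA: "(\<Sum>k\<in>J. A i k * (\<Sum>l\<in>J. B k l * A l m)) = A i m" if i: "i \<in> J" for i
    proof -
      have "(\<Sum>k\<in>J. A i k * (\<Sum>l\<in>J. B k l * A l m)) =
          (\<Sum>k\<in>J. \<Sum>l\<in>J. A i k * B k l * A l m)"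
        by (simp add: sum_distrib_left mult.assoc)
      also have "\<dots> = (\<Sum>l\<in>J. \<Sum>k\<in>J. A i k * B k l * A l m)"
        by (rule sum.swap)
      also have "\<dots> = (\<Sum>l\<in>J. (\<Sum>k\<in>J. A i k * B k l) * A l m)"
        by (simp add: sum_distrib_right)
      also have "\<dots> = (\<Sum>l\<in>J. if i = l then A l m else 0)"
        using AB[OF i] by (intro sum.cong) auto
      also have "\<dots> = A i m"
        using insert.hyps(1) i by simp
      finally show ?thesis .
    qed
    have "(\<Sum>k\<in>insert m J. A i k * C k j) = (if i = j then 1 else 0)"
      if ij: "i \<in> insert m J" "j \<in> insert m J" for i j
    proof (cases "j = m")
      case jm: True
      have "(\<Sum>k\<in>J. A i k * C k m) = - A i m / A m m" if "i \<in> J"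
      proof -
        have "(\<Sum>k\<in>J. A i k * C k m) =
            (\<Sum>k\<in>J. A i k * (\<Sum>l\<in>J. B k l * A l m) * (- 1 / A m m))"
          by (intro sum.cong) (auto simp: C1(4))
        also have "\<dots> = (\<Sum>k\<in>J. A i k * (\<Sum>l\<in>J. B k l * A l m)) * (- 1 / A m m)"
          by (rule sum_distrib_right[symmetric])
        finally show ?thesis using ABA[OF that] by simp
      qed
      then show ?thesis
        using ij jm d mJ insert.hyps(1) by (auto simp: C1 row)
    next
      case False
      then have "(\<Sum>k\<in>J. A i k * C k j) = (\<Sum>k\<in>J. A i k * B k j)"
        using ij by (intro sum.cong) (auto simp: C1)
      then show ?thesis
        using ij False mJ insert.hyps(1) AB by (auto simp: C1 row ne)
    qed
    moreover have "(\<Sum>k\<in>insert m J. C i k * A k j) = (if i = j then 1 else 0)"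
      if ij: "i \<in> insert m J" "j \<in> insert m J" for i j
    proof (cases "i = m")
      case True
      have "(\<Sum>k\<in>J. C m k * A k j) = 0"
        by (intro sum.neutral) (auto simp: C1)
      then show ?thesis
        using ij True d mJ insert.hyps(1) by (auto simp: C1 row ne)
    next
      case False
      then have "(\<Sum>k\<in>J. C i k * A k j) = (\<Sum>k\<in>J. B i k * A k j)"
        using ij by (intro sum.cong) (auto simp: C1)
      then show ?thesis
        using ij False d mJ insert.hyps(1) BA by (auto simp: C1 row ne)
    qed
    moreover have "triangular_on (insert m J) w C"
      unfolding triangular_on_def
    proof (intro conjI ballI impI)
      show "C i i \<noteq> 0" if "i \<in> insert m J" for i
        using that d B by (auto simp: C1 triangular_on_def)
      show "i = j \<or> w i < w j" if "i \<in> insert m J" "j \<in> insert m J" "C i j \<noteq> 0" for i j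
      proof (cases "i \<in> J \<and> j = m")
        case True
        then have "(\<Sum>k\<in>J. B i k * A k m) \<noteq> 0"
          using that by (auto simp: C1)
        \<comment> \<open>A nonzero entry of B a has a nonzero summand, and its index gives the
          chain \<open>w i \<le> w k < w m\<close>.\<close>
        then obtain k where "k \<in> J" "B i k * A k m \<noteq> 0"
          by (rule sum.not_neutral_contains_not_neutral)
        then have k: "k \<in> J" "B i k \<noteq> 0" "A k m \<noteq> 0"
          by auto
        have "i = k \<or> w i < w k"
          using B True k unfolding triangular_on_def by blast
        moreover have "w k < w m"
          using insert.prems k ne(1)[of k] unfolding triangular_on_def by (metis insertCI)
        ultimately show ?thesis using True by auto
      next
        case False
        with that consider "i = j" | "i \<in> J" "j \<in> J" "B i j \<noteq> 0"
          using C1(2,3) by auto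
        then show ?thesis
          using B unfolding triangular_on_def by cases blast+
      qed
    qed
    ultimately show ?thesis
      unfolding mutually_inverse_on_def by blast
  qed
qed

section \<open>Tables of marks\<close>

text \<open>Conjugate subgroups have equal order, so for a conjugacy class the image is a singleton
  and no representative has to be chosen.\<close>

definition class_card :: "'a set set \<Rightarrow> nat" where
  "class_card X = the_elem (card ` X)"

context group
begin

section \<open>Conjugation and conjugacy classes of subgroups\<close>

lemma conj_map_mult:
  assumes "g \<in> carrier G" "h \<in> carrier G" "x \<in> carrier G"
  shows "conj_map G (g \<otimes> h) x = conj_map G g (conj_map G h x)"
  using assms by (simp add: conj_map_def inv_mult_group m_assoc)

lemma inj_on_conj_map:
  assumes "g \<in> carrier G"
  shows "inj_on (conj_map G g) (carrier G)"
  using assms by (auto simp: inj_on_def conj_map_def)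

lemma card_conj_map_image:
  assumes "P \<subseteq> carrier G" "g \<in> carrier G"
  shows "card (conj_map G g ` P) = card P"
  using assms by (intro card_image inj_on_subset[OF inj_on_conj_map])

lemma conj_map_image_subgroup:
  assumes P: "subgroup P G" and g: "g \<in> carrier G"
  shows "subgroup (conj_map G g ` P) G"
proof (rule subgroupI)
  have sub: "P \<subseteq> carrier G" by (rule subgroup.subset[OF P])
  show "conj_map G g ` P \<subseteq> carrier G"
    using sub g by (auto simp: conj_map_def)
  show "conj_map G g ` P \<noteq> {}"
    using subgroup.one_closed[OF P] by blast
  fix a assume "a \<in> conj_map G g ` P"
  then obtain x where x: "x \<in> P" "a = conj_map G g x" by blast
  have "inv a = conj_map G g (inv x)"
    using x sub g by (auto simp: conj_map_def inv_mult_group m_assoc)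
  then show "inv a \<in> conj_map G g ` P"
    using x subgroup.m_inv_closed[OF P] by blast
  fix b assume "b \<in> conj_map G g ` P"
  then obtain y where y: "y \<in> P" "b = conj_map G g y" by blast
  have "a \<otimes> b = conj_map G g (x \<otimes> y)"
  proof -
    have c: "x \<in> carrier G" "y \<in> carrier G" using x y sub by auto
    then have "inv g \<otimes> (g \<otimes> (y \<otimes> inv g)) = y \<otimes> inv g"
      using g by (simp add: m_assoc[symmetric])
    then show ?thesis
      using x y c g by (simp add: conj_map_def m_assoc)
  qed
  then show "a \<otimes> b \<in> conj_map G g ` P"
    using x y subgroup.m_closed[OF P] by blast
qed

lemma conj_map_image_mult:
  assumes "P \<subseteq> carrier G" "g \<in> carrier G" "h \<in> carrier G"
  shows "conj_map G g ` conj_map G h ` P = conj_map G (g \<otimes> h) ` P"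
  unfolding image_image using assms by (intro image_cong) (auto simp: conj_map_mult)

lemma S_class_self:
  assumes "P \<subseteq> carrier G"
  shows "P \<in> S_class G P"
proof -
  have "conj_map G \<one> ` P = P"
    using assms by (force simp: conj_map_def)
  then show ?thesis unfolding S_class_def by blast
qed

lemma S_class_conj:
  assumes P: "P \<subseteq> carrier G" and g: "g \<in> carrier G"
  shows "S_class G (conj_map G g ` P) = S_class G P"
proof -
  \<comment> \<open>Stated for arbitrary \<open>R\<close> and \<open>k\<close> so that it yields
    both inclusions: once for \<open>P\<close> and \<open>g\<close>, once for the conjugate of
    \<open>P\<close> and \<open>inv g\<close>.\<close>
  have sub: "S_class G (conj_map G k ` R) \<subseteq> S_class G R"
    if R: "R \<subseteq> carrier G" and k: "k \<in> carrier G" for R k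
  proof
    fix T assume "T \<in> S_class G (conj_map G k ` R)"
    then obtain l where "l \<in> carrier G" "T = conj_map G (l \<otimes> k) ` R"
      using conj_map_image_mult[OF R _ k] by (auto simp: S_class_def)
    then show "T \<in> S_class G R"
      using k unfolding S_class_def by blast
  qed
  have "conj_map G g ` P \<subseteq> carrier G"
    using P g by (auto simp: conj_map_def)
  from sub[OF this inv_closed[OF g]] sub[OF P g] show ?thesis
    by (simp add: conj_map_image_inv[OF P g])
qed

lemma S_class_subgroup:
  assumes "subgroup P G" "Q \<in> S_class G P"
  shows "subgroup Q G"
  using assms conj_map_image_subgroup unfolding S_class_def by auto

lemma card_S_class:
  assumes "P \<subseteq> carrier G" "Q \<in> S_class G P"
  shows "card Q = card P"
  using assms card_conj_map_image unfolding S_class_def by auto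

lemma finite_subgroup_classes:
  assumes "finite (carrier G)"
  shows "finite (subgroup_classes G)"
proof -
  have "subgroup_classes G \<subseteq> S_class G ` Pow (carrier G)"
    using subgroup.subset unfolding subgroup_classes_def by blast
  then show ?thesis using assms finite_subset by blast
qed

section \<open>Triangularity of the table of marks and of its inverse\<close>

lemma conj_subset_of_fixed_coset:
  assumes Q: "Q \<subseteq> carrier G" and P: "subgroup P G"
    and C: "C \<in> fixed_points (lcosets P) (coset_act G P) Q"
  shows "\<exists>a \<in> carrier G. conj_map G a ` Q \<subseteq> P"
proof -
  obtain a where a: "a \<in> carrier G" "C = a <# P"
    using C by (auto simp: fixed_points_def LCOSETS_def)
  \<comment> \<open>If q fixes the coset aP, then qa = ax for some x in P, and conjugating q by the
    inverse of a gives x.\<close>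
  have "conj_map G (inv a) q \<in> P" if q: "q \<in> Q" for q
  proof -
    have qc: "q \<in> carrier G" using q Q by auto
    have "q <# C = C"
      using C q by (auto simp: fixed_points_def coset_act_def)
    moreover have "q \<otimes> a \<in> q <# C"
      using lcos_self[OF a(1) P] unfolding a(2) l_coset_def by blast
    ultimately obtain x where x: "x \<in> P" "q \<otimes> a = a \<otimes> x"
      unfolding a(2) l_coset_def by auto
    have xc: "x \<in> carrier G" using x subgroup.subset[OF P] by auto
    have "conj_map G (inv a) q = inv a \<otimes> (q \<otimes> a)"
      using a qc by (simp add: conj_map_def m_assoc)
    also have "\<dots> = x"
      using a xc by (simp add: x(2) m_assoc[symmetric])
    finally show ?thesis using x by simp
  qed
  then show ?thesis using a by (intro bexI[of _ "inv a"]) auto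
qed

lemma base_coset_fixed:
  assumes P: "subgroup P G"
  shows "P \<in> fixed_points (lcosets P) (coset_act G P) P"
proof -
  have "x <# P = P" if "x \<in> P" for x
    using that P by (metis lcos_mult_one l_repr_independence one_closed subgroup.subset)
  moreover have "P \<in> lcosets P"
    using lcos_mult_one[OF subgroup.subset[OF P]] unfolding LCOSETS_def by force
  ultimately show ?thesis
    by (auto simp: fixed_points_def coset_act_def)
qed

lemma finite_lcosets:
  assumes "finite (carrier G)"
  shows "finite (lcosets P)"
  using assms by (simp add: LCOSETS_def)

lemma class_card_S_class:
  assumes "P \<subseteq> carrier G"
  shows "class_card (S_class G P) = card P"
proof -
  have "card ` S_class G P = (\<lambda>_. card P) ` S_class G P"
    using card_S_class[OF assms] by (rule image_cong[OF refl])
  also have "\<dots> = {card P}"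
    using S_class_self[OF assms] by blast
  finally show ?thesis by (simp add: class_card_def)
qed

text \<open>The base coset makes the diagonal nonzero. Any other nonzero entry puts a conjugate of
  \<open>Q\<close> inside \<open>P\<close>: either it fills \<open>P\<close>, and the two classes
  coincide, or its order is strictly smaller.\<close>

lemma triangular_Mark:
  assumes fin: "finite (carrier G)"
  shows "triangular_on (subgroup_classes G) class_card (Mark G)"
  unfolding triangular_on_def
proof (intro conjI ballI impI)
  fix X assume "X \<in> subgroup_classes G"
  then obtain P where P: "subgroup P G" "X = S_class G P"
    by (auto simp: subgroup_classes_def)
  have "finite (fixed_points (lcosets P) (coset_act G P) P)"
    using finite_lcosets[OF fin] by (simp add: fixed_points_def)
  then show "Mark G X X \<noteq> 0"
    using base_coset_fixed[OF P(1)] by (auto simp: P Mark_S_class)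
next
  fix X Y assume "X \<in> subgroup_classes G" "Y \<in> subgroup_classes G" and nz: "Mark G X Y \<noteq> 0"
  then obtain Q P where Q: "subgroup Q G" "X = S_class G Q" and P: "subgroup P G" "Y = S_class G P"
    by (auto simp: subgroup_classes_def)
  have Qc: "Q \<subseteq> carrier G" and Pc: "P \<subseteq> carrier G"
    using Q P subgroup.subset by auto
  have "fixed_points (lcosets P) (coset_act G P) Q \<noteq> {}"
    using nz by (auto simp: P Q Mark_S_class)
  then obtain a where a: "a \<in> carrier G" "conj_map G a ` Q \<subseteq> P"
    using conj_subset_of_fixed_coset[OF Qc P(1)] by blast
  have fP: "finite P" using Pc fin finite_subset by blast
  show "X = Y \<or> class_card X < class_card Y"
  proof (cases "conj_map G a ` Q = P")
    case True
    then show ?thesis using S_class_conj[OF Qc a(1)] P Q by simp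
  next
    case False
    then have "card Q < card P"
      using psubset_card_mono[OF fP, of "conj_map G a ` Q"] a card_conj_map_image[OF Qc a(1)]
      by (simp add: psubset_eq)
    then show ?thesis by (simp add: P Q class_card_S_class Pc Qc)
  qed
qed

text \<open>\<open>Mob\<close> is an arbitrarily chosen inverse, so nothing about its shape is known
  from its definition. Uniqueness of inverses on the index set identifies it there with the
  triangular inverse \<open>B\<close>.\<close>

lemma Mob_properties:
  assumes "finite (carrier G)"
  shows Mark_Mob_inverse: "mutually_inverse_on (subgroup_classes G) (Mark G) (Mob G)"
    and triangular_Mob: "triangular_on (subgroup_classes G) class_card (Mob G)"
proof -
  obtain B where B: "mutually_inverse_on (subgroup_classes G) (Mark G) B"
      "triangular_on (subgroup_classes G) class_card B"
    using triangular_on_has_inverse[OF finite_subgroup_classes triangular_Mark] assms by blast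
  then show inv: "mutually_inverse_on (subgroup_classes G) (Mark G) (Mob G)"
    unfolding Mob_def by (intro mutually_inverse_on_inverse_on) (auto simp: invertible_on_def)
  have "B X Y = Mob G X Y" if "X \<in> subgroup_classes G" "Y \<in> subgroup_classes G" for X Y
    using mutually_inverse_on_unique[OF finite_subgroup_classes B(1) inv] assms that by blast
  with B(2) show "triangular_on (subgroup_classes G) class_card (Mob G)"
    by (simp add: triangular_on_def)
qed

end

section \<open>Orbit counts\<close>

lemma card_fixed_points_action_iso:
  assumes iso: "action_iso Q E act E' act'"
    and closed: "\<And>u x. u \<in> Q \<Longrightarrow> x \<in> E \<Longrightarrow> act u x \<in> E"
  shows "card (fixed_points E act Q) = card (fixed_points E' act' Q)"
proof -
  obtain h where h: "bij_betw h E E'" "\<And>u x. u \<in> Q \<Longrightarrow> x \<in> E \<Longrightarrow> h (act u x) = act' u (h x)"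
    using iso by (auto simp: action_iso_def)
  have inj: "inj_on h E" and img: "h ` E = E'" using h(1) by (auto simp: bij_betw_def)
  \<comment> \<open>Closure under the action puts \<open>act u x\<close> in \<open>E\<close>, where
    \<open>h\<close> is injective.\<close>
  have "act u x = x \<longleftrightarrow> act' u (h x) = h x" if "u \<in> Q" "x \<in> E" for u x
    using that closed h(2) inj by (metis inj_on_eq_iff)
  then have "h ` fixed_points E act Q = fixed_points E' act' Q"
    using img by (force simp: fixed_points_def)
  moreover have "inj_on h (fixed_points E act Q)"
    using inj by (rule inj_on_subset) (auto simp: fixed_points_def)
  ultimately show ?thesis using card_image by metis
qed

section \<open>Orbits, stabilizers and coset spaces\<close>

context group_action
begin

lemma is_group: "group G"
  using group_hom group_hom.axioms(1) by blast

lemma orbit_subset: "x \<in> E \<Longrightarrow> orbit G \<phi> x \<subseteq> E"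
  using element_image by (auto simp: orbit_def)

lemma orbit_eqI:
  assumes "x \<in> E" "y \<in> orbit G \<phi> x"
  shows "orbit G \<phi> y = orbit G \<phi> x"
proof -
  have "y \<in> E" using assms orbit_subset by blast
  then have "orbit G \<phi> y \<in> orbits G E \<phi>" "orbit G \<phi> x \<in> orbits G E \<phi>"
    using assms by (auto simp: orbits_def)
  then show ?thesis
    using disjoint_union assms orbit_refl[OF \<open>y \<in> E\<close>] by blast
qed

lemma orbit_closed:
  assumes "X \<in> orbits G E \<phi>" "g \<in> carrier G" "x \<in> X"
  shows "\<phi> g x \<in> X"
proof -
  obtain z where z: "z \<in> E" "X = orbit G \<phi> z" using assms(1) by (auto simp: orbits_def)
  then have "X = orbit G \<phi> x" using orbit_eqI assms(3) by auto
  then show ?thesis using assms(2) by (auto simp: orbit_def)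
qed

text \<open>If s fixes x, then the conjugate of s by g fixes gx. The reverse inclusion is the same
  fact for the point gx and the inverse of g.\<close>

lemma stabilizer_translate:
  assumes x: "x \<in> E" and g: "g \<in> carrier G"
  shows "stabilizer G \<phi> (\<phi> g x) = conj_map G g ` stabilizer G \<phi> x"
proof -
  interpret group G by (rule is_group)
  have sub: "conj_map G k ` stabilizer G \<phi> y \<subseteq> stabilizer G \<phi> (\<phi> k y)"
    if y: "y \<in> E" and k: "k \<in> carrier G" for k y
  proof
    fix a assume "a \<in> conj_map G k ` stabilizer G \<phi> y"
    then obtain s where s: "s \<in> carrier G" "\<phi> s y = y" "a = conj_map G k s"
      by (auto simp: stabilizer_def)
    have "a \<in> carrier G" using s k by (simp add: conj_map_def)
    moreover have "\<phi> a (\<phi> k y) = \<phi> k y"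
    proof -
      have "a \<otimes> k = k \<otimes> s" using s k by (simp add: conj_map_def m_assoc)
      then show ?thesis
        using composition_rule[OF y \<open>a \<in> carrier G\<close> k] composition_rule[OF y k s(1)] s by simp
    qed
    ultimately show "a \<in> stabilizer G \<phi> (\<phi> k y)" by (simp add: stabilizer_def)
  qed
  have gx: "\<phi> g x \<in> E" using element_image[OF g x] by simp
  have undo: "\<phi> (inv g) (\<phi> g x) = x" using orbit_sym_aux[OF g x] by simp
  have "conj_map G g ` conj_map G (inv g) ` stabilizer G \<phi> (\<phi> g x) \<subseteq>
      conj_map G g ` stabilizer G \<phi> x"
    using sub[OF gx inv_closed[OF g]] undo by (intro image_mono) simp
  moreover have "conj_map G g ` conj_map G (inv g) ` stabilizer G \<phi> (\<phi> g x) =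
      stabilizer G \<phi> (\<phi> g x)"
    using conj_map_image_inv[OF stabilizer_subset inv_closed[OF g]] g by simp
  ultimately show ?thesis using sub[OF x g] by blast
qed

text \<open>This attaches to an orbit an element of \<open>subgroup_classes\<close> without choosing
  a base point; it serves as the isomorphism type of the orbit.\<close>

lemma stabilizer_image_orbit:
  assumes "x \<in> E"
  shows "stabilizer G \<phi> ` orbit G \<phi> x = S_class G (stabilizer G \<phi> x)"
proof -
  have "orbit G \<phi> x = (\<lambda>g. \<phi> g x) ` carrier G"
    by (auto simp: orbit_def)
  moreover have "S_class G (stabilizer G \<phi> x) =
      (\<lambda>g. conj_map G g ` stabilizer G \<phi> x) ` carrier G"
    by (auto simp: S_class_def)
  ultimately show ?thesis
    using stabilizer_translate[OF assms] by (simp add: image_image)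
qed

lemma orbit_action_iso_lcosets:
  assumes y: "y \<in> E"
  shows "action_iso (carrier G) (orbit G \<phi> y) \<phi>
    (lcosets (stabilizer G \<phi> y)) (coset_act G (stabilizer G \<phi> y))"
proof -
  interpret group G by (rule is_group)
  let ?R = "stabilizer G \<phi> y"
  \<comment> \<open>A point goes to the set of all group elements carrying \<open>y\<close> to it.
    This set is a left coset of the stabilizer, so no single such element has to be
    selected.\<close>
  define h where "h z = {g \<in> carrier G. \<phi> g y = z}" for z
  have h: "h (\<phi> g y) = g <# ?R" if g: "g \<in> carrier G" for g
  proof
    show "g <# ?R \<subseteq> h (\<phi> g y)"
      using g composition_rule[OF y g] by (auto simp: h_def l_coset_def stabilizer_def)
    show "h (\<phi> g y) \<subseteq> g <# ?R"
    proof
      fix k assume "k \<in> h (\<phi> g y)"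
      then have k: "k \<in> carrier G" "\<phi> k y = \<phi> g y" by (auto simp: h_def)
      have "inv g \<otimes> k \<in> ?R"
        using composition_rule[OF y inv_closed[OF g] k(1)] orbit_sym_aux[OF g y] k g
        by (simp add: stabilizer_def)
      moreover have "k = g \<otimes> (inv g \<otimes> k)"
        using g k by (simp add: m_assoc[symmetric])
      ultimately show "k \<in> g <# ?R" unfolding l_coset_def by blast
    qed
  qed
  have "inj_on h (orbit G \<phi> y)"
    by (rule inj_onI) (force simp: h_def orbit_def)
  moreover have "h ` orbit G \<phi> y = lcosets ?R"
    using h by (force simp: orbit_def LCOSETS_def)
  moreover have "h (\<phi> u z) = coset_act G ?R u (h z)"
    if u: "u \<in> carrier G" and z: "z \<in> orbit G \<phi> y" for u z
  proof -
    obtain g where g: "g \<in> carrier G" "z = \<phi> g y" using z by (auto simp: orbit_def)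
    have "h (\<phi> u z) = (u \<otimes> g) <# ?R"
      using h[of "u \<otimes> g"] composition_rule[OF y u g(1)] u g by simp
    also have "\<dots> = u <# h z"
      using h[OF g(1)] g u stabilizer_subset by (simp add: lcos_m_assoc)
    finally show ?thesis
      using h[OF g(1)] g by (auto simp: coset_act_def LCOSETS_def)
  qed
  ultimately show ?thesis unfolding action_iso_def bij_betw_def by blast
qed

text \<open>The point matched with the base coset \<open>R\<close> has stabilizer exactly
  \<open>R\<close>, because g fixes that coset iff g lies in \<open>R\<close>.\<close>

lemma stabilizer_of_action_iso_lcosets:
  assumes X: "X \<in> orbits G E \<phi>" and R: "subgroup R G"
    and iso: "action_iso (carrier G) X \<phi> (lcosets R) (coset_act G R)"
  shows "R \<in> stabilizer G \<phi> ` X"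
proof -
  interpret group G by (rule is_group)
  obtain h where h: "bij_betw h X (lcosets R)"
    "\<And>u x. u \<in> carrier G \<Longrightarrow> x \<in> X \<Longrightarrow> h (\<phi> u x) = coset_act G R u (h x)"
    using iso by (auto simp: action_iso_def)
  have RL: "R \<in> lcosets R"
    using base_coset_fixed[OF R] by (simp add: fixed_points_def)
  then obtain y where y: "y \<in> X" "h y = R"
    using h(1) by (metis bij_betw_def imageE)
  have "\<phi> g y = y \<longleftrightarrow> g \<in> R" if g: "g \<in> carrier G" for g
  proof -
    have "\<phi> g y = y \<longleftrightarrow> h (\<phi> g y) = h y"
      using orbit_closed[OF X g y(1)] y(1) h(1) by (metis bij_betw_def inj_on_eq_iff)
    also have "\<dots> \<longleftrightarrow> g <# R = R"
      using h(2)[OF g y(1)] y RL by (simp add: coset_act_def)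
    also have "\<dots> \<longleftrightarrow> g \<in> R"
      using lcos_self[OF g R] base_coset_fixed[OF R] RL
      by (auto simp: fixed_points_def coset_act_def)
    finally show ?thesis .
  qed
  then have "stabilizer G \<phi> y = R"
    using subgroup.subset[OF R] by (auto simp: stabilizer_def)
  then show ?thesis using y by blast
qed

lemma action_iso_lcosets_iff:
  assumes X: "X \<in> orbits G E \<phi>" and R: "subgroup R G"
  shows "action_iso (carrier G) X \<phi> (lcosets R) (coset_act G R) \<longleftrightarrow>
    stabilizer G \<phi> ` X = S_class G R"
proof -
  interpret group G by (rule is_group)
  obtain x where x: "x \<in> E" "X = orbit G \<phi> x" using X by (auto simp: orbits_def)
  have XE: "X \<subseteq> E" using orbit_subset x by simp
  have orb: "X = orbit G \<phi> y" if "y \<in> X" for y using orbit_eqI x that by auto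
  show ?thesis
  proof
    assume "action_iso (carrier G) X \<phi> (lcosets R) (coset_act G R)"
    then obtain y where y: "y \<in> X" "R = stabilizer G \<phi> y"
      using stabilizer_of_action_iso_lcosets[OF X R] by blast
    then show "stabilizer G \<phi> ` X = S_class G R"
      using stabilizer_image_orbit[of y] orb[OF y(1)] XE by auto
  next
    assume "stabilizer G \<phi> ` X = S_class G R"
    then obtain y where y: "y \<in> X" "R = stabilizer G \<phi> y"
      using S_class_self[OF subgroup.subset[OF R]] by blast
    then show "action_iso (carrier G) X \<phi> (lcosets R) (coset_act G R)"
      using orbit_action_iso_lcosets[of y] orb[OF y(1)] XE by auto
  qed
qed

section \<open>Marks of a finite set with action as a linear function of its orbit counts\<close>

definition class_count :: "'a set set \<Rightarrow> nat" where
  "class_count Y = card {X \<in> orbits G E \<phi>. stabilizer G \<phi> ` X = Y}"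

lemma class_count_S_class:
  assumes "subgroup R G"
  shows "class_count (S_class G R) = orbit_count G E \<phi> R"
  unfolding class_count_def orbit_count_def
  using action_iso_lcosets_iff[OF _ assms] by metis

text \<open>Fixed points are counted orbit by orbit, and orbits are grouped by their class of
  stabilizers. Every orbit in the group of the class of \<open>R\<close> is isomorphic to the coset
  space of \<open>R\<close> and contributes the same mark.\<close>

lemma card_fixed_points_eq_sum_Mark:
  assumes fG: "finite (carrier G)" and fE: "finite E" and Q: "subgroup Q G"
  shows "of_nat (card (fixed_points E \<phi> Q)) =
    (\<Sum>Y\<in>subgroup_classes G. Mark G (S_class G Q) Y * of_nat (class_count Y))"
proof -
  interpret group G by (rule is_group)
  have fO: "finite (orbits G E \<phi>)"
    by (rule finite_UnionD) (simp add: fE orbits_coverture)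
  have Qc: "Q \<subseteq> carrier G" by (rule subgroup.subset[OF Q])
  have "(\<Union>X\<in>orbits G E \<phi>. fixed_points X \<phi> Q) = fixed_points (\<Union>(orbits G E \<phi>)) \<phi> Q"
    by (auto simp: fixed_points_def)
  also have "\<dots> = fixed_points E \<phi> Q"
    by (simp only: orbits_coverture)
  finally have "card (fixed_points E \<phi> Q) = card (\<Union>X\<in>orbits G E \<phi>. fixed_points X \<phi> Q)"
    by simp
  also have "\<dots> = (\<Sum>X\<in>orbits G E \<phi>. card (fixed_points X \<phi> Q))"
  proof (rule card_UN_disjoint[OF fO])
    have "fixed_points X \<phi> Q \<inter> fixed_points Y \<phi> Q \<subseteq> X \<inter> Y" for X Y
      by (auto simp: fixed_points_def)
    then show "\<forall>X\<in>orbits G E \<phi>. \<forall>Y\<in>orbits G E \<phi>. X \<noteq> Y \<longrightarrow>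
        fixed_points X \<phi> Q \<inter> fixed_points Y \<phi> Q = {}"
      using disjoint_union by (metis subset_empty)
    have "finite X" if "X \<in> orbits G E \<phi>" for X
      using fE by (rule rev_finite_subset) (metis Union_upper orbits_coverture that)
    then show "\<forall>X\<in>orbits G E \<phi>. finite (fixed_points X \<phi> Q)"
      by (simp add: fixed_points_def)
  qed
  also have "\<dots> = (\<Sum>Y\<in>subgroup_classes G.
      \<Sum>X\<in>{X \<in> orbits G E \<phi>. stabilizer G \<phi> ` X = Y}. card (fixed_points X \<phi> Q))"
  proof (rule sum.group[symmetric, OF fO finite_subgroup_classes[OF fG]])
    show "(`) (stabilizer G \<phi>) ` orbits G E \<phi> \<subseteq> subgroup_classes G"
    proof
      fix Y assume "Y \<in> (`) (stabilizer G \<phi>) ` orbits G E \<phi>"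
      then obtain x where x: "x \<in> E" "Y = stabilizer G \<phi> ` orbit G \<phi> x"
        by (auto simp: orbits_def)
      then have "Y = S_class G (stabilizer G \<phi> x)"
        using stabilizer_image_orbit by simp
      then show "Y \<in> subgroup_classes G"
        using stabilizer_subgroup[OF x(1)] by (auto simp: subgroup_classes_def)
    qed
  qed
  finally have "of_nat (card (fixed_points E \<phi> Q)) = (\<Sum>Y\<in>subgroup_classes G.
      \<Sum>X\<in>{X \<in> orbits G E \<phi>. stabilizer G \<phi> ` X = Y}. of_nat (card (fixed_points X \<phi> Q)) :: rat)"
    by simp
  also have "\<dots> = (\<Sum>Y\<in>subgroup_classes G. Mark G (S_class G Q) Y * of_nat (class_count Y))"
  proof (rule sum.cong[OF refl])
    fix Y assume "Y \<in> subgroup_classes G"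
    then obtain R where R: "subgroup R G" "Y = S_class G R"
      by (auto simp: subgroup_classes_def)
    have "of_nat (card (fixed_points X \<phi> Q)) = Mark G (S_class G Q) Y"
      if X: "X \<in> orbits G E \<phi>" "stabilizer G \<phi> ` X = Y" for X
    proof -
      have "action_iso (carrier G) X \<phi> (lcosets R) (coset_act G R)"
        using action_iso_lcosets_iff[OF X(1) R(1)] X(2) R(2) by simp
      \<comment> \<open>Counting the points fixed by \<open>Q\<close> needs only the restriction of
        the isomorphism to the action of \<open>Q\<close>.\<close>
      then have "action_iso Q X \<phi> (lcosets R) (coset_act G R)"
        using Qc unfolding action_iso_def by (meson subsetD)
      then have "card (fixed_points X \<phi> Q) = card (fixed_points (lcosets R) (coset_act G R) Q)"
        using orbit_closed[OF X(1)] Qc by (intro card_fixed_points_action_iso) auto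
      then show ?thesis by (simp add: R Mark_S_class[OF Q R(1)])
    qed
    then show "(\<Sum>X\<in>{X \<in> orbits G E \<phi>. stabilizer G \<phi> ` X = Y}.
        of_nat (card (fixed_points X \<phi> Q))) = Mark G (S_class G Q) Y * of_nat (class_count Y)"
      by (simp add: class_count_def)
  qed
  finally show ?thesis .
qed

text \<open>The previous lemma writes the vector of marks as \<open>Mark\<close> times the vector of
  orbit counts, and \<open>Mob\<close> cancels \<open>Mark\<close> from the left. The function
  \<open>a\<close> presents the marks as a vector indexed by classes rather than by
  subgroups.\<close>

lemma Mob_marks_eq_orbit_count:
  assumes fG: "finite (carrier G)" and fE: "finite E" and Q: "subgroup Q G"
    and a: "\<And>R. subgroup R G \<Longrightarrow> a (S_class G R) = of_nat (card (fixed_points E \<phi> R))"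
  shows "(\<Sum>X\<in>subgroup_classes G. Mob G (S_class G Q) X * a X) =
    of_nat (orbit_count G E \<phi> Q)"
proof -
  interpret group G by (rule is_group)
  let ?I = "subgroup_classes G" and ?c = "\<lambda>Y. of_nat (class_count Y) :: rat"
  have QI: "S_class G Q \<in> ?I" using Q by (auto simp: subgroup_classes_def)
  have fI: "finite ?I" by (rule finite_subgroup_classes[OF fG])
  have "a X = (\<Sum>Y\<in>?I. Mark G X Y * ?c Y)" if "X \<in> ?I" for X
    using that a card_fixed_points_eq_sum_Mark[OF fG fE] by (auto simp: subgroup_classes_def)
  then have "(\<Sum>X\<in>?I. Mob G (S_class G Q) X * a X) =
      (\<Sum>X\<in>?I. \<Sum>Y\<in>?I. Mob G (S_class G Q) X * Mark G X Y * ?c Y)"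
    by (simp add: sum_distrib_left mult.assoc)
  also have "\<dots> = (\<Sum>Y\<in>?I. (\<Sum>X\<in>?I. Mob G (S_class G Q) X * Mark G X Y) * ?c Y)"
    by (subst sum.swap) (simp add: sum_distrib_right)
  also have "\<dots> = (\<Sum>Y\<in>?I. if S_class G Q = Y then ?c Y else 0)"
    using Mark_Mob_inverse[OF fG] QI by (intro sum.cong) (auto simp: mutually_inverse_on_def)
  also have "\<dots> = of_nat (orbit_count G E \<phi> Q)"
    using fI QI by (simp add: class_count_S_class[OF Q])
  finally show ?thesis .
qed

end

section \<open>Fusion systems\<close>

context fusion_system
begin

section \<open>F-conjugacy and its effect on orders and marks\<close>

lemma F_extensional:
  assumes "subgroup P S" "subgroup Q S" "f \<in> F P Q"
  shows "f \<in> extensional P" "f ` P \<subseteq> Q" "inj_on f P"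
  using F_subset_Inj[OF assms(1,2)] assms(3) by (auto simp: Inj_hom_def mon_def hom_def Pi_def)

lemma conj_map_in_F:
  assumes "subgroup P S" "subgroup Q S" "g \<in> carrier S" "conj_map S g ` P \<subseteq> Q"
  shows "restrict (conj_map S g) P \<in> F P Q"
  using Hom_S_subset[OF assms(1,2)] assms(3,4) unfolding Hom_S_def by blast

lemma F_conj_S_class:
  assumes P: "subgroup P S" and Q: "Q \<in> S_class S P"
  shows "F_conj S F P Q"
proof -
  obtain g where g: "g \<in> carrier S" "Q = conj_map S g ` P"
    using Q by (auto simp: S_class_def)
  have sQ: "subgroup Q S" by (rule S_class_subgroup[OF P Q])
  have "restrict (conj_map S g) P \<in> Iso_F F P (restrict (conj_map S g) P ` P)"
    using conj_map_in_F[OF P sQ g(1)] g(2) F_factor[OF P sQ] by blast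
  then show ?thesis using P sQ g by (auto simp: F_conj_def)
qed

lemma F_conj_refl: "subgroup P S \<Longrightarrow> F_conj S F P P"
  using F_conj_S_class S_class_self subgroup.subset by blast

lemma F_conj_sym: "F_conj S F P Q \<Longrightarrow> F_conj S F Q P"
  by (auto simp: F_conj_def Iso_F_def)

lemma F_conj_trans:
  assumes "F_conj S F P Q" "F_conj S F Q R"
  shows "F_conj S F P R"
proof -
  have s: "subgroup P S" "subgroup Q S" "subgroup R S"
    using assms by (auto simp: F_conj_def)
  obtain f f' where f: "f \<in> F P Q" "f' \<in> F Q P"
    "compose P f' f = (\<lambda>x\<in>P. x)" "compose Q f f' = (\<lambda>x\<in>Q. x)"
    using assms(1) by (auto simp: F_conj_def Iso_F_def)
  obtain g g' where g: "g \<in> F Q R" "g' \<in> F R Q"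
    "compose Q g' g = (\<lambda>x\<in>Q. x)" "compose R g g' = (\<lambda>x\<in>R. x)"
    using assms(2) by (auto simp: F_conj_def Iso_F_def)
  have im: "f ` P \<subseteq> Q" "f' ` Q \<subseteq> P" "g ` Q \<subseteq> R" "g' ` R \<subseteq> Q"
    using F_extensional s f g by blast+
  have pt: "\<And>x. x \<in> P \<Longrightarrow> f' (f x) = x" "\<And>x. x \<in> Q \<Longrightarrow> f (f' x) = x"
    "\<And>x. x \<in> Q \<Longrightarrow> g' (g x) = x" "\<And>x. x \<in> R \<Longrightarrow> g (g' x) = x"
    using f g by (metis compose_eq restrict_apply')+
  have "compose P g f \<in> F P R" "compose R f' g' \<in> F R P"
    using F_comp s f g by blast+
  moreover have "compose P (compose R f' g') (compose P g f) = (\<lambda>x\<in>P. x)"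
    using im pt by (intro ext) (auto simp: compose_def image_subset_iff)
  moreover have "compose R (compose P g f) (compose R f' g') = (\<lambda>x\<in>R. x)"
    using im pt by (intro ext) (auto simp: compose_def image_subset_iff)
  ultimately show ?thesis
    using s by (auto simp: F_conj_def Iso_F_def)
qed

lemma Iso_F_image:
  assumes "subgroup P S" "subgroup Q S" "f \<in> Iso_F F P Q"
  shows "f ` P = Q"
proof -
  obtain f' where f: "f \<in> F P Q" "f' \<in> F Q P" "compose Q f f' = (\<lambda>x\<in>Q. x)"
    using assms(3) by (auto simp: Iso_F_def)
  have "f (f' x) = x" "f' x \<in> P" if "x \<in> Q" for x
    using f F_extensional(2)[OF assms(2,1) f(2)] that by (metis compose_eq restrict_apply', blast)
  then show ?thesis
    using F_extensional(2)[OF assms(1,2) f(1)] by force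
qed

lemma card_F_conj:
  assumes "F_conj S F P Q"
  shows "card P = card Q"
proof -
  obtain f where s: "subgroup P S" "subgroup Q S" and f: "f \<in> Iso_F F P Q"
    using assms by (auto simp: F_conj_def)
  then have "f \<in> F P Q" by (simp add: Iso_F_def)
  then show ?thesis
    using card_image[OF F_extensional(3)[OF s]] Iso_F_image[OF s f] by metis
qed

text \<open>For an isomorphism f from \<open>P\<close> to \<open>Q\<close>, the points fixed by
  \<open>Q\<close> are those fixed by \<open>P\<close> under the action twisted by f. Stability
  compares the twisted action with the original one.\<close>

lemma card_fixed_points_F_conj:
  assumes action: "group_action S E act" and stable: "F_stable S F E act"
    and PQ: "F_conj S F P Q"
  shows "card (fixed_points E act P) = card (fixed_points E act Q)"
proof -
  have s: "subgroup P S" "subgroup Q S" and subs: "P \<subseteq> carrier S" "Q \<subseteq> carrier S"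
    using PQ subgroup.subset by (auto simp: F_conj_def)
  obtain f where f: "f \<in> Iso_F F P Q" using PQ by (auto simp: F_conj_def)
  then have fF: "f \<in> F P Q" by (simp add: Iso_F_def)
  have im: "f ` P = Q" by (rule Iso_F_image[OF s f])
  \<comment> \<open>Stability speaks of morphisms into the whole of \<open>S\<close>, so
    \<open>f\<close> is composed with the inclusion of \<open>Q\<close>, obtained as conjugation by
    the identity.\<close>
  have "conj_map S \<one> ` Q \<subseteq> carrier S" using subs by (auto simp: conj_map_def)
  then have "compose P (restrict (conj_map S \<one>) Q) f \<in> F P (carrier S)"
    using F_comp[OF s subgroup_self fF] conj_map_in_F[OF s(2) subgroup_self] by blast
  also have "compose P (restrict (conj_map S \<one>) Q) f = f"
    using F_extensional(1)[OF s fF] im subs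
    by (intro ext) (auto simp: compose_def conj_map_def extensional_def)
  finally have "action_iso P E (\<lambda>u. act (f u)) E act"
    using stable s by (auto simp: F_stable_def)
  then have "card (fixed_points E (\<lambda>u. act (f u)) P) = card (fixed_points E act P)"
    using im subs group_action.element_image[OF action]
    by (intro card_fixed_points_action_iso) blast+
  moreover have "fixed_points E (\<lambda>u. act (f u)) P = fixed_points E act Q"
    using im by (auto simp: fixed_points_def)
  ultimately show ?thesis by simp
qed

text \<open>S-conjugate subgroups are F-conjugate, so one member of an S-class decides whether the
  whole class lies in a given F-class.\<close>

lemma S_class_subset_F_class_iff:
  assumes "subgroup R S"
  shows "S_class S R \<subseteq> F_class S F P \<longleftrightarrow> F_conj S F P R"
proof
  show "F_conj S F P R" if "S_class S R \<subseteq> F_class S F P"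
    using that S_class_self[OF subgroup.subset[OF assms]] by (auto simp: F_class_def)
  show "S_class S R \<subseteq> F_class S F P" if "F_conj S F P R"
    using F_conj_trans[OF that] F_conj_S_class[OF assms] by (auto simp: F_class_def)
qed

section \<open>\<open>FMob\<close> and sums over fully normalized representatives\<close>

context
  fixes Pstar :: "'a set set"
  assumes reps: "fully_normalized_representatives S F Pstar"
begin

lemma representative_subgroup: "P \<in> Pstar \<Longrightarrow> subgroup P S"
  using reps by (auto simp: fully_normalized_representatives_def fully_normalized_def)

lemma finite_representatives: "finite Pstar"
proof (rule finite_subset)
  show "Pstar \<subseteq> Pow (carrier S)" using representative_subgroup subgroup.subset by blast
  show "finite (Pow (carrier S))" using finite_S by simp
qed

lemma representatives_F_conj_iff:
  assumes "P \<in> Pstar" "Q \<in> Pstar"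
  shows "F_conj S F Q P \<longleftrightarrow> Q = P"
  using assms reps representative_subgroup F_conj_refl
  unfolding fully_normalized_representatives_def by metis

text \<open>A nonzero summand comes from some R that is F-conjugate to \<open>P\<close>, hence of
  the same order. Triangularity of \<open>Mob\<close> then makes \<open>Q\<close> either S-conjugate
  to R, so that \<open>Q\<close> and \<open>P\<close> are the same representative, or of smaller
  order than \<open>P\<close>.\<close>

lemma triangular_FMob: "triangular_on Pstar card (FMob S F)"
proof -
  let ?I = "\<lambda>P. {X \<in> subgroup_classes S. X \<subseteq> F_class S F P}"
  have tri: "X = Y \<or> class_card X < class_card Y"
    if "X \<in> subgroup_classes S" "Y \<in> subgroup_classes S" "Mob S X Y \<noteq> 0" for X Y
    using triangular_Mob[OF finite_S] that by (auto simp: triangular_on_def)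
  have nonzero: "\<exists>R. X = S_class S R \<and> F_conj S F P R \<and> (S_class S Q = X \<or> card Q < card P)"
    if Q: "Q \<in> Pstar" and X: "X \<in> ?I P" "Mob S (S_class S Q) X \<noteq> 0" for P Q X
  proof -
    obtain R where R: "subgroup R S" "X = S_class S R"
      using X(1) by (auto simp: subgroup_classes_def)
    have PR: "F_conj S F P R"
      using X(1) R S_class_subset_F_class_iff by simp
    have sQ: "subgroup Q S" by (rule representative_subgroup[OF Q])
    then have "S_class S Q = X \<or> class_card (S_class S Q) < class_card X"
      using X tri by (auto simp: subgroup_classes_def)
    then have "S_class S Q = X \<or> card Q < card P"
      using R sQ PR by (auto simp: class_card_S_class subgroup.subset card_F_conj)
    then show ?thesis using R PR by blast
  qed
  show ?thesis
    unfolding triangular_on_def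
  proof (intro conjI ballI impI)
    fix P assume P: "P \<in> Pstar"
    have sP: "subgroup P S" by (rule representative_subgroup[OF P])
    have PI: "S_class S P \<in> ?I P"
      using sP S_class_subset_F_class_iff F_conj_refl by (auto simp: subgroup_classes_def)
    \<comment> \<open>For \<open>Q = P\<close> the strict alternative in \<open>nonzero\<close> is
      impossible, so only the class of \<open>P\<close> itself contributes.\<close>
    have "FMob S F P P = (\<Sum>X\<in>?I P. if X = S_class S P then Mob S (S_class S P) X else 0)"
      unfolding FMob_def using nonzero[OF P] by (intro sum.cong) auto
    also have "\<dots> = Mob S (S_class S P) (S_class S P)"
      using PI finite_subgroup_classes[OF finite_S] by simp
    also have "\<dots> \<noteq> 0"
      using triangular_Mob[OF finite_S] PI by (auto simp: triangular_on_def)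
    finally show "FMob S F P P \<noteq> 0" .
  next
    fix Q P assume Q: "Q \<in> Pstar" and P: "P \<in> Pstar" and "FMob S F Q P \<noteq> 0"
    then obtain X where X: "X \<in> ?I P" "Mob S (S_class S Q) X \<noteq> 0"
      unfolding FMob_def by (meson sum.not_neutral_contains_not_neutral)
    from nonzero[OF Q X] obtain R
      where R: "X = S_class S R" "F_conj S F P R" "S_class S Q = X \<or> card Q < card P"
      by blast
    have sQ: "subgroup Q S" by (rule representative_subgroup[OF Q])
    have "F_conj S F Q P" if "S_class S Q = X"
      using that X(1) S_class_subset_F_class_iff[OF sQ] F_conj_sym by auto
    then show "Q = P \<or> card Q < card P"
      using R(3) representatives_F_conj_iff[OF P Q] by blast
  qed
qed

text \<open>Each S-class lies in the F-class of exactly one representative, so these F-classes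
  partition the index set of \<open>Mob\<close>.\<close>

lemma sum_representatives_F_classes:
  fixes c :: "'a set set \<Rightarrow> rat"
  shows "(\<Sum>R\<in>Pstar. \<Sum>X\<in>{X \<in> subgroup_classes S. X \<subseteq> F_class S F R}. c X) =
    (\<Sum>X\<in>subgroup_classes S. c X)"
proof -
  let ?I = "\<lambda>P. {X \<in> subgroup_classes S. X \<subseteq> F_class S F P}"
  have "(\<Sum>X\<in>(\<Union>R\<in>Pstar. ?I R). c X) = (\<Sum>R\<in>Pstar. \<Sum>X\<in>?I R. c X)"
  proof (rule sum.UNION_disjoint[OF finite_representatives])
    show "\<forall>R\<in>Pstar. finite (?I R)" using finite_subgroup_classes[OF finite_S] by simp
    have "P = Q" if PQ: "P \<in> Pstar" "Q \<in> Pstar" and X: "X \<in> ?I P" "X \<in> ?I Q" for P Q X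
    proof -
      obtain R where R: "subgroup R S" "X = S_class S R"
        using X(1) by (auto simp: subgroup_classes_def)
      then have "F_conj S F P R" "F_conj S F Q R"
        using X S_class_subset_F_class_iff by auto
      then have "F_conj S F Q P"
        using F_conj_trans F_conj_sym by blast
      then show ?thesis
        using representatives_F_conj_iff[OF PQ] by simp
    qed
    then show "\<forall>P\<in>Pstar. \<forall>Q\<in>Pstar. P \<noteq> Q \<longrightarrow> ?I P \<inter> ?I Q = {}" by blast
  qed
  moreover have "(\<Union>R\<in>Pstar. ?I R) = subgroup_classes S"
  proof -
    have "\<exists>P\<in>Pstar. X \<subseteq> F_class S F P" if X: "X \<in> subgroup_classes S" for X
    proof -
      obtain R where R: "subgroup R S" "X = S_class S R"
        using X by (auto simp: subgroup_classes_def)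
      obtain P where "P \<in> Pstar" "F_conj S F P R"
        using reps R(1) unfolding fully_normalized_representatives_def by blast
      then show ?thesis using R S_class_subset_F_class_iff by blast
    qed
    then show ?thesis by blast
  qed
  ultimately show ?thesis by simp
qed

text \<open>Marks of a stable set are constant on F-classes, so the mark at \<open>R\<close> can be
  moved inside the sum defining \<open>FMob\<close>. The double sum then becomes a row of
  \<open>Mob\<close> applied to all the marks.\<close>

lemma FMob_marks_eq_orbit_count:
  assumes action: "group_action S E act" and fE: "finite E" and stable: "F_stable S F E act"
    and Q: "Q \<in> Pstar"
  shows "(\<Sum>R\<in>Pstar. FMob S F Q R * of_nat (card (fixed_points E act R))) =
    of_nat (orbit_count S E act Q)"
proof -
  have marks: "card (fixed_points E act (SOME R. R \<in> X)) = card (fixed_points E act P)"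
    if P: "F_conj S F P R" and X: "X = S_class S R" for X P R
  proof -
    have R: "subgroup R S" using P by (simp add: F_conj_def)
    have "(SOME R. R \<in> X) \<in> X"
      using S_class_self[OF subgroup.subset[OF R]] X by (auto intro: someI)
    then show ?thesis
      using F_conj_trans[OF P F_conj_S_class[OF R]] card_fixed_points_F_conj[OF action stable] X
      by metis
  qed
  \<comment> \<open>The mark of a class is read off at an arbitrary member, and \<open>marks\<close>
    shows that the choice does not matter.\<close>
  let ?a = "\<lambda>X. of_nat (card (fixed_points E act (SOME R. R \<in> X))) :: rat"
  have "(\<Sum>R\<in>Pstar. FMob S F Q R * of_nat (card (fixed_points E act R))) =
      (\<Sum>R\<in>Pstar. \<Sum>X\<in>{X \<in> subgroup_classes S. X \<subseteq> F_class S F R}. Mob S (S_class S Q) X * ?a X)"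
  proof (rule sum.cong[OF refl])
    fix R
    have "?a X = of_nat (card (fixed_points E act R))"
      if X: "X \<in> subgroup_classes S" "X \<subseteq> F_class S F R" for X
    proof -
      obtain T where T: "subgroup T S" "X = S_class S T"
        using X(1) by (auto simp: subgroup_classes_def)
      then show ?thesis using marks[of R T X] X(2) S_class_subset_F_class_iff by simp
    qed
    then show "FMob S F Q R * of_nat (card (fixed_points E act R)) =
        (\<Sum>X\<in>{X \<in> subgroup_classes S. X \<subseteq> F_class S F R}. Mob S (S_class S Q) X * ?a X)"
      unfolding FMob_def by (simp add: sum_distrib_right)
  qed
  also have "\<dots> = (\<Sum>X\<in>subgroup_classes S. Mob S (S_class S Q) X * ?a X)"
    by (rule sum_representatives_F_classes)
  also have "\<dots> = of_nat (orbit_count S E act Q)"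
    using group_action.Mob_marks_eq_orbit_count[OF action finite_S fE representative_subgroup[OF Q],
        of ?a] marks F_conj_refl by auto
  finally show ?thesis .
qed

end

end

section \<open>Invertibility of \<open>FMob\<close> and the marks of the sets \<alpha>\<close>

theorem theorem1p1:
  fixes S :: "('a, 'm) monoid_scheme" and p :: nat
    and F :: "'a set \<Rightarrow> 'a set \<Rightarrow> ('a \<Rightarrow> 'a) set" and Pstar :: "'a set set"
  assumes "saturated_fusion_system S p F"
    and "fully_normalized_representatives S F Pstar"
  shows "invertible_on Pstar (FMob S F) \<and>
    (\<forall>Qs\<in>Pstar. \<forall>Ps\<in>Pstar. \<forall>(E :: 'b set) act. is_alpha S F Ps E act \<longrightarrow>
       inverse_on Pstar (FMob S F) Qs Ps = of_nat (card (fixed_points E act Qs)))"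
proof -
  interpret saturated_fusion_system S p F by (rule assms(1))
  note reps = assms(2)
  let ?A = "FMob S F" and ?B = "inverse_on Pstar (FMob S F)"
  have fin: "finite Pstar" by (rule finite_representatives[OF reps])
  have inv: "invertible_on Pstar ?A"
    using triangular_on_has_inverse[OF fin triangular_FMob[OF reps]]
    by (auto simp: invertible_on_def)
  then have BA: "(\<Sum>k\<in>Pstar. ?B Q k * ?A k R) = (if Q = R then 1 else 0)"
    if "Q \<in> Pstar" "R \<in> Pstar" for Q R
    using mutually_inverse_on_inverse_on[OF inv] that by (simp add: mutually_inverse_on_def)
  have "?B Q P = of_nat (card (fixed_points E act Q))"
    if Q: "Q \<in> Pstar" and P: "P \<in> Pstar" and alpha: "is_alpha S F P E act"
    for Q P and E :: "'b set" and act
  proof -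
    let ?a = "\<lambda>R. of_nat (card (fixed_points E act R)) :: rat"
    have Aa: "(\<Sum>R\<in>Pstar. ?A k R * ?a R) = (if k = P then 1 else 0)" if k: "k \<in> Pstar" for k
    proof -
      have "(\<Sum>R\<in>Pstar. ?A k R * ?a R) = of_nat (orbit_count S E act k)"
        using alpha by (intro FMob_marks_eq_orbit_count[OF reps _ _ _ k]) (auto simp: is_alpha_def)
      \<comment> \<open>As a representative, \<open>k\<close> is fully normalized, so its orbit
        count is prescribed; it is F-conjugate to \<open>P\<close> only if it equals
        \<open>P\<close>.\<close>
      also have "orbit_count S E act k = (if k = P then 1 else 0)"
        using alpha k reps representatives_F_conj_iff[OF reps P k]
        by (auto simp: is_alpha_def fully_normalized_representatives_def)
      finally show ?thesis by simp
    qed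
    \<comment> \<open>By \<open>Aa\<close>, the inner sum is the unit vector at \<open>P\<close>,
      which picks out column \<open>P\<close> of \<open>?B\<close>. Reassociating then lets
      \<open>?B\<close> cancel \<open>?A\<close> and leaves the vector of marks.\<close>
    have "?B Q P = (\<Sum>k\<in>Pstar. ?B Q k * (\<Sum>R\<in>Pstar. ?A k R * ?a R))"
      using fin P by (simp add: Aa if_distrib cong: if_cong)
    also have "\<dots> = (\<Sum>R\<in>Pstar. (\<Sum>k\<in>Pstar. ?B Q k * ?A k R) * ?a R)"
      by (simp add: sum_distrib_left sum_distrib_right mult.assoc) (rule sum.swap)
    also have "\<dots> = (\<Sum>R\<in>Pstar. if Q = R then ?a R else 0)"
      using BA[OF Q] by (intro sum.cong) auto
    also have "\<dots> = ?a Q" using fin Q by simp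
    finally show ?thesis .
  qed
  with inv show ?thesis by blast
qed

end
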